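(* For all integers $k\geq 1$ and $d\geq 4$, the graph $DDPG_{k,d}$ is an extremal graph having a set of $k$ totally disjoint diametral paths of length $d$; that is, it has such a set, and its number of edges is the minimum possible among all graphs having $k$ totally disjoint diametral paths of length $d$.
   Context: All graphs are finite, simple and connected. The length of a path is its number of edges. The diameter of $G$ is the greatest distance between any pair of vertices; a diametral path is a shortest path connecting two vertices whose distance equals the diameter (so having a diametral path of length $d$ means the diameter is $d$). Two paths are totally disjoint if they have no vertex in common, including their end vertices; a set of paths is totally disjoint if every two of its members are. $MinE(k,d)$ denotes the minimum number of edges in a graph having $k$ totally disjoint diametral paths of length $d$; a graph having $k$ totally disjoint diametral paths of length $d$ and exactly $MinE(k,d)$ edges is called extremal. For $d\ge 4$, $DDPG_{k,d}$ consists of $k$ vertex-disjoint paths $p_1,\dots,p_k$ of length $d$, where $p_i$ has vertices $p_{i,0},\dots,p_{i,d}$ connected by edges in that order, together with the following edges: letting $h=\lfloor d/2\rfloor$ and $h'=\lceil d/2\rceil$, each path $p_i$ with $1<i\le k$ is connected to $p_1$ by the two edges $(p_{1,h},p_{i,h-1})$ and $(p_{1,h'},p_{i,h'+1})$. *)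

theory Defs
  imports Main
begin

record 'v ugraph =
  verts :: "'v set"
  edges :: "'v set set"

definition simple_graph :: "'v ugraph \<Rightarrow> bool" where
  "simple_graph G \<longleftrightarrow>
     finite (verts G) \<and> (\<forall>e \<in> edges G. e \<subseteq> verts G \<and> card e = 2)"

text \<open>A path is represented by the list of its vertices.\<close>

definition is_path :: "'v ugraph \<Rightarrow> 'v list \<Rightarrow> bool" where
  "is_path G p \<longleftrightarrow>
     p \<noteq> [] \<and> distinct p \<and> set p \<subseteq> verts G \<and>
     successively (\<lambda>u v. {u, v} \<in> edges G) p"

definition path_length :: "'v list \<Rightarrow> nat" where
  "path_length p = length p - 1"

definition path_between :: "'v ugraph \<Rightarrow> 'v \<Rightarrow> 'v \<Rightarrow> 'v list \<Rightarrow> bool" where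
  "path_between G u v p \<longleftrightarrow> is_path G p \<and> hd p = u \<and> last p = v"

definition connected_graph :: "'v ugraph \<Rightarrow> bool" where
  "connected_graph G \<longleftrightarrow>
     verts G \<noteq> {} \<and> (\<forall>u \<in> verts G. \<forall>v \<in> verts G. \<exists>p. path_between G u v p)"

text \<open>The following two notions are only meaningful for finite connected graphs.\<close>

definition distance :: "'v ugraph \<Rightarrow> 'v \<Rightarrow> 'v \<Rightarrow> nat" where
  "distance G u v = (LEAST n. \<exists>p. path_between G u v p \<and> path_length p = n)"

definition diameter :: "'v ugraph \<Rightarrow> nat" where
  "diameter G = Max {distance G u v | u v. u \<in> verts G \<and> v \<in> verts G}"

definition shortest_path :: "'v ugraph \<Rightarrow> 'v list \<Rightarrow> bool" where
  "shortest_path G p \<longleftrightarrow>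
     is_path G p \<and> path_length p = distance G (hd p) (last p)"

definition diametral_path :: "'v ugraph \<Rightarrow> 'v list \<Rightarrow> bool" where
  "diametral_path G p \<longleftrightarrow>
     shortest_path G p \<and> distance G (hd p) (last p) = diameter G"

definition totally_disjoint :: "'v list set \<Rightarrow> bool" where
  "totally_disjoint P \<longleftrightarrow> pairwise (\<lambda>p q. set p \<inter> set q = {}) P"

definition has_disjoint_diametral_paths :: "nat \<Rightarrow> nat \<Rightarrow> 'v ugraph \<Rightarrow> bool" where
  "has_disjoint_diametral_paths k d G \<longleftrightarrow>
     simple_graph G \<and> connected_graph G \<and>
     (\<exists>P. finite P \<and> card P = k \<and> totally_disjoint P \<and>
          (\<forall>p \<in> P. diametral_path G p \<and> path_length p = d))"

text \<open>
  A definition cannot quantify over vertex types. Graphs on natural numbers suffice here,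
  since every finite graph is isomorphic to one of them.
\<close>

definition MinE :: "nat \<Rightarrow> nat \<Rightarrow> nat" where
  "MinE k d =
     (LEAST m. \<exists>G :: nat ugraph. has_disjoint_diametral_paths k d G \<and> card (edges G) = m)"

definition extremal :: "nat \<Rightarrow> nat \<Rightarrow> 'v ugraph \<Rightarrow> bool" where
  "extremal k d G \<longleftrightarrow>
     has_disjoint_diametral_paths k d G \<and> card (edges G) = MinE k d"

text \<open>
  The pair \<open>(i, j)\<close> is the vertex $p_{i,j}$; the number \<open>(d + 1) div 2\<close> is
  the ceiling of $d/2$.
\<close>

definition DDPG :: "nat \<Rightarrow> nat \<Rightarrow> (nat \<times> nat) ugraph" where
  "DDPG k d =
     (let h = d div 2; h' = (d + 1) div 2 in
      \<lparr> verts = {1..k} \<times> {0..d},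
        edges = {{(i, j), (i, j + 1)} | i j. i \<in> {1..k} \<and> j < d}
              \<union> {{(1, h), (i, h - 1)} | i. 1 < i \<and> i \<le> k}
              \<union> {{(1, h'), (i, h' + 1)} | i. 1 < i \<and> i \<le> k} \<rparr>)"

end

theory Submission
  imports Defs Complex_Main "HOL-Library.Countable"
begin

text \<open>
  For the lower bound it suffices that \<open>|V| + k \<le> |E| + 2\<close>, since \<open>|V| \<ge> k (d + 1)\<close>.
  Look for a potential \<open>\<phi>\<close> on the vertices that has a constant slope \<open>a p\<close> along each of the \<open>k\<close>
  disjoint paths \<open>p\<close> and is constant across all other edges. These are \<open>|E|\<close> linear equations in
  \<open>|V| + k\<close> unknowns, so if the inequality fails, the solutions modulo constants have
  dimension at least two, and one of them attains the maximal slope, normalised to \<open>1\<close>, in absolute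
  value on two different paths. Then \<open>\<phi>\<close> is 1-Lipschitz and rises by \<open>d\<close> along each of these two
  paths, suitably oriented. Going from the lower of the two bottom ends to the top end of the other
  path, \<open>\<phi>\<close> rises by at least \<open>d\<close>, but such a walk also needs an edge outside all the paths, on
  which \<open>\<phi>\<close> does not rise. So these two ends have distance greater than \<open>d\<close>, a contradiction.

  In \<open>DDPG\<close> the second coordinate is 1-Lipschitz, so the ends of each row have distance \<open>d\<close>, and
  every vertex is within \<open>h\<close> of one of the hubs \<open>(1, h)\<close> and \<open>(1, h')\<close>, where \<open>h + h' = d\<close>;
  so the diameter is \<open>d\<close>.
\<close>

section \<open>Homogeneous linear systems\<close>

text \<open>Gaussian elimination, by induction on the set of equations: each equation either is
  trivial or eliminates one unknown. Arbitrary index sets allow edges as equations and vertices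
  together with paths as unknowns.\<close>

lemma homogeneous_system_nontrivial:
  fixes M :: "'e \<Rightarrow> 'x \<Rightarrow> 'a::field"
  assumes "finite E" "finite X" "card E < card X"
  shows "\<exists>f. (\<forall>x. x \<notin> X \<longrightarrow> f x = 0) \<and> (\<exists>x\<in>X. f x \<noteq> 0) \<and>
             (\<forall>e\<in>E. (\<Sum>x\<in>X. M e x * f x) = 0)"
  using assms
proof (induction E arbitrary: X M rule: finite_induct)
  case empty
  then obtain x where "x \<in> X" by fastforce
  then show ?case
    by (intro exI[of _ "\<lambda>y. if y = x then 1 else 0"]) auto
next
  case (insert e E)
  show ?case
  proof (cases "\<forall>x\<in>X. M e x = 0")
    case True
    have "card E < card X" using insert by simp
    then obtain f where "\<forall>x. x \<notin> X \<longrightarrow> f x = 0" "\<exists>x\<in>X. f x \<noteq> 0"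
      "\<forall>e\<in>E. (\<Sum>x\<in>X. M e x * f x) = 0"
      using insert.IH[OF insert.prems(1)] by blast
    then show ?thesis using True by (intro exI[of _ f]) auto
  next
    case False
    then obtain x0 where x0: "x0 \<in> X" "M e x0 \<noteq> 0" by blast
    define X' where "X' = X - {x0}"
    \<comment> \<open>The row of \<open>e\<close> is subtracted from the other rows so that the
      column of \<open>x0\<close> vanishes.\<close>
    define M' where "M' = (\<lambda>e' x. M e' x - M e' x0 * M e x / M e x0)"
    have X: "X = insert x0 X'" "x0 \<notin> X'" "finite X'"
      using x0 insert.prems unfolding X'_def by auto
    have "card E < card X'" using insert.prems insert.hyps X by simp
    then obtain f where f: "\<forall>x. x \<notin> X' \<longrightarrow> f x = 0" "\<exists>x\<in>X'. f x \<noteq> 0"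
      "\<forall>e\<in>E. (\<Sum>x\<in>X'. M' e x * f x) = 0"
      using insert.IH[OF X(3)] by blast
    define s where "s = (\<Sum>x\<in>X'. M e x * f x)"
    \<comment> \<open>Back substitution: the value at \<open>x0\<close> is the one that solves
      equation \<open>e\<close>.\<close>
    define g where "g = f(x0 := - s / M e x0)"
    have sum_g: "(\<Sum>x\<in>X. M e' x * g x) = M e' x0 * (- s / M e x0) + (\<Sum>x\<in>X'. M e' x * f x)" for e'
    proof -
      have "(\<Sum>x\<in>X'. M e' x * g x) = (\<Sum>x\<in>X'. M e' x * f x)"
        using X(2) by (intro sum.cong) (auto simp: g_def)
      then show ?thesis unfolding X(1) using X(2,3) by (simp add: g_def)
    qed
    have "(\<Sum>x\<in>X. M e' x * g x) = 0" if "e' \<in> insert e E" for e'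
    proof (cases "e' = e")
      case True
      then show ?thesis using x0 by (simp add: sum_g s_def)
    next
      case False
      have "(\<Sum>x\<in>X'. M' e' x * f x) = (\<Sum>x\<in>X'. M e' x * f x) - M e' x0 / M e x0 * s"
        unfolding M'_def s_def sum_distrib_left sum_subtractf[symmetric]
        by (intro sum.cong) (simp_all add: algebra_simps)
      then show ?thesis using f(3) False that by (auto simp: sum_g)
    qed
    moreover have "\<forall>x. x \<notin> X \<longrightarrow> g x = 0" using f(1) X by (simp add: g_def)
    moreover have "\<exists>x\<in>X. g x \<noteq> 0" using f(2) X by (auto simp: g_def)
    ultimately show ?thesis by (intro exI[of _ g]) blast
  qed
qed

section \<open>Paths and distances\<close>

lemma distance_le:
  assumes "path_between G u v p"
  shows "distance G u v \<le> path_length p"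
  unfolding distance_def using assms by (intro Least_le) auto

lemma distance_attained:
  assumes "path_between G u v p"
  obtains q where "path_between G u v q" "path_length q = distance G u v"
proof -
  have "\<exists>n q. path_between G u v q \<and> path_length q = n" using assms by blast
  then have "\<exists>q. path_between G u v q \<and> path_length q = distance G u v"
    unfolding distance_def by (rule LeastI_ex)
  then show ?thesis using that by blast
qed

lemma lipschitz_successively:
  fixes \<psi> :: "'v \<Rightarrow> real"
  assumes "\<And>x y. {x, y} \<in> edges G \<Longrightarrow> \<bar>\<psi> x - \<psi> y\<bar> \<le> c"
    and "successively (\<lambda>u v. {u, v} \<in> edges G) p" "p \<noteq> []"
  shows "\<bar>\<psi> (hd p) - \<psi> (last p)\<bar> \<le> c * path_length p"
  using assms(2,3)
proof (induction p rule: induct_list012)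
  case (3 x y p)
  have "\<bar>\<psi> y - \<psi> (last (y # p))\<bar> \<le> c * path_length (y # p)"
    using "3.IH"(2) "3.prems" by simp
  moreover have "\<bar>\<psi> x - \<psi> y\<bar> \<le> c" using assms(1) "3.prems" by simp
  ultimately have "\<bar>\<psi> x - \<psi> (last (y # p))\<bar> \<le> c + c * path_length (y # p)" by linarith
  then show ?case by (simp add: path_length_def algebra_simps)
qed (auto simp: path_length_def)

lemma lipschitz_distance:
  fixes \<psi> :: "'v \<Rightarrow> real"
  assumes "\<And>x y. {x, y} \<in> edges G \<Longrightarrow> \<bar>\<psi> x - \<psi> y\<bar> \<le> c"
    and "path_between G u v p"
  shows "\<bar>\<psi> u - \<psi> v\<bar> \<le> c * distance G u v"
proof -
  obtain q where q: "path_between G u v q" "path_length q = distance G u v"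
    using distance_attained[OF assms(2)] .
  have "\<bar>\<psi> (hd q) - \<psi> (last q)\<bar> \<le> c * path_length q"
    using q(1) by (intro lipschitz_successively[of G, OF assms(1)])
      (auto simp: path_between_def is_path_def)
  then show ?thesis using q by (auto simp: path_between_def)
qed

text \<open>With \<open>c = 1\<close> this bounds distances from below; with \<open>c = 0\<close> it
  shows that a function preserved by all edges is constant.\<close>

lemma connected_graph_lipschitz:
  fixes \<psi> :: "'v \<Rightarrow> real"
  assumes "connected_graph G" "\<And>x y. {x, y} \<in> edges G \<Longrightarrow> \<bar>\<psi> x - \<psi> y\<bar> \<le> c"
    and "u \<in> verts G" "v \<in> verts G"
  shows "\<bar>\<psi> u - \<psi> v\<bar> \<le> c * distance G u v"
proof -
  obtain p where "path_between G u v p"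
    using assms(1,3,4) by (auto simp: connected_graph_def)
  then show ?thesis using lipschitz_distance[of G \<psi> c] assms(2) by blast
qed

lemma finite_distances:
  assumes "finite (verts G)"
  shows "finite {distance G u v | u v. u \<in> verts G \<and> v \<in> verts G}"
proof -
  have "{distance G u v | u v. u \<in> verts G \<and> v \<in> verts G}
      = (\<lambda>(u, v). distance G u v) ` (verts G \<times> verts G)" by auto
  then show ?thesis using assms by simp
qed

lemma distance_le_diameter:
  assumes "finite (verts G)" "u \<in> verts G" "v \<in> verts G"
  shows "distance G u v \<le> diameter G"
  unfolding diameter_def using assms by (intro Max_ge finite_distances) auto

lemma finite_edges:
  assumes "simple_graph G"
  shows "finite (edges G)"
proof (rule finite_subset)
  show "edges G \<subseteq> Pow (verts G)" using assms by (auto simp: simple_graph_def)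
  show "finite (Pow (verts G))" using assms by (simp add: simple_graph_def)
qed

section \<open>Potentials that are affine along disjoint paths\<close>

text \<open>The relation is oriented, since a slope needs a direction along the path.\<close>

definition consecutive :: "'v list \<Rightarrow> 'v \<Rightarrow> 'v \<Rightarrow> bool" where
  "consecutive p x y \<longleftrightarrow> (\<exists>j. Suc j < length p \<and> p ! j = x \<and> p ! Suc j = y)"

lemma consecutive_in_set:
  assumes "consecutive p x y"
  shows "x \<in> set p" "y \<in> set p"
  using assms by (auto simp: consecutive_def)

text \<open>The indices of the two occurrences would have to be successors of each other. Hence a
  path orients each of its edges in only one way.\<close>

lemma consecutive_asym:
  assumes "distinct p" "consecutive p x y"
  shows "\<not> consecutive p y x"
proof
  assume "consecutive p y x"
  then obtain i j where "Suc i < length p" "p ! i = x" "p ! Suc i = y"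
    "Suc j < length p" "p ! j = y" "p ! Suc j = x"
    using assms(2) by (auto simp: consecutive_def)
  then have "Suc i = j" "Suc j = i"
    using assms(1) by (metis Suc_lessD nth_eq_iff_index_eq)+
  then show False by simp
qed

text \<open>The second clause includes chords, that is, edges between nonconsecutive vertices of one
  path.\<close>

definition affine_potential ::
  "'v ugraph \<Rightarrow> 'v list set \<Rightarrow> ('v \<Rightarrow> real) \<Rightarrow> ('v list \<Rightarrow> real) \<Rightarrow> bool" where
  "affine_potential G P \<phi> a \<longleftrightarrow>
     (\<forall>x y. {x, y} \<in> edges G \<longrightarrow>
        (\<forall>p\<in>P. consecutive p x y \<longrightarrow> \<phi> y - \<phi> x = a p) \<and>
        ((\<forall>p\<in>P. \<not> consecutive p x y \<and> \<not> consecutive p y x) \<longrightarrow> \<phi> x = \<phi> y))"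

text \<open>The conditions are linear in the pair of potential and slopes; this lets two independent
  solutions be mixed.\<close>

lemma affine_potential_combine:
  assumes "affine_potential G P \<phi> a" "affine_potential G P \<psi> b"
  shows "affine_potential G P (\<lambda>x. c * \<phi> x + t * \<psi> x) (\<lambda>p. c * a p + t * b p)"
  unfolding affine_potential_def
proof (intro allI impI conjI ballI)
  fix x y p assume "{x, y} \<in> edges G" "p \<in> P" "consecutive p x y"
  then have "\<phi> y - \<phi> x = a p" "\<psi> y - \<psi> x = b p"
    using assms by (auto simp: affine_potential_def)
  then show "c * \<phi> y + t * \<psi> y - (c * \<phi> x + t * \<psi> x) = c * a p + t * b p"
    by (metis add_diff_add right_diff_distrib')
next
  fix x y assume "{x, y} \<in> edges G" "\<forall>p\<in>P. \<not> consecutive p x y \<and> \<not> consecutive p y x"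
  then have "\<phi> x = \<phi> y" "\<psi> x = \<psi> y"
    using assms unfolding affine_potential_def by blast+
  then show "c * \<phi> x + t * \<psi> x = c * \<phi> y + t * \<psi> y" by simp
qed

text \<open>A case rule that forgets the orientation, which is irrelevant for Lipschitz
  bounds.\<close>

lemma affine_potential_edge:
  assumes "affine_potential G P \<phi> a" "{x, y} \<in> edges G"
  obtains p where "p \<in> P" "x \<in> set p" "y \<in> set p" "\<bar>\<phi> x - \<phi> y\<bar> = \<bar>a p\<bar>"
  | "\<phi> x = \<phi> y"
proof (cases "\<exists>p\<in>P. consecutive p x y \<or> consecutive p y x")
  case True
  then obtain p where p: "p \<in> P" "consecutive p x y \<or> consecutive p y x" by blast
  have "{y, x} \<in> edges G" using assms(2) by (simp add: insert_commute)
  then have "\<bar>\<phi> x - \<phi> y\<bar> = \<bar>a p\<bar>"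
    using p assms by (fastforce simp: affine_potential_def)
  then show ?thesis using that(1) p consecutive_in_set by metis
next
  case False
  then show ?thesis using assms that(2) unfolding affine_potential_def by blast
qed

text \<open>Normalising the potential to \<open>0\<close> at a root and the slopes to
  \<open>0\<close> outside \<open>Q\<close> leaves \<open>card (verts G) - 1 + card Q\<close>
  unknowns, more than there are edges. A nontrivial solution has a nonzero slope: otherwise the
  potential would be constant by connectedness, hence \<open>0\<close>. The choice of
  \<open>Q\<close> makes it possible to prescribe a path on which the slope vanishes.\<close>

lemma affine_potential_exists:
  assumes "simple_graph G" "connected_graph G" "finite P" "totally_disjoint P"
    and P: "\<And>p. p \<in> P \<Longrightarrow> is_path G p"
    and "Q \<subseteq> P" "Suc (card (edges G)) < card (verts G) + card Q"
  obtains \<phi> a where "affine_potential G P \<phi> a" "\<And>p. p \<notin> Q \<Longrightarrow> a p = 0" "\<exists>p\<in>Q. a p \<noteq> 0"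
proof -
  have finV: "finite (verts G)" using assms(1) by (simp add: simple_graph_def)
  have finQ: "finite Q" using assms(3,6) finite_subset by blast
  obtain r where r: "r \<in> verts G" using assms(2) by (auto simp: connected_graph_def)
  have same: "p = q" if "p \<in> P" "q \<in> P" "x \<in> set p" "x \<in> set q" for p q x
    using assms(4) that by (auto simp: totally_disjoint_def pairwise_def)
  \<comment> \<open>Every edge gets an orientation that no path traverses backwards; by disjointness
    at most one path uses the edge.\<close>
  have "\<exists>x y. e = {x, y} \<and> x \<noteq> y \<and> (\<forall>p\<in>P. \<not> consecutive p y x)" if "e \<in> edges G" for e
  proof -
    have "card e = 2" using assms(1) that by (auto simp: simple_graph_def)
    then obtain x y where xy: "e = {x, y}" "x \<noteq> y" by (auto simp: card_2_iff)
    show ?thesis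
    proof (cases "\<exists>p\<in>P. consecutive p y x")
      case True
      then obtain p where p: "p \<in> P" "consecutive p y x" by blast
      have "\<not> consecutive q x y" if "q \<in> P" for q
        using same[OF p(1) that] consecutive_in_set p consecutive_asym P
        by (metis is_path_def)
      then show ?thesis using xy by (intro exI[of _ y] exI[of _ x]) auto
    next
      case False
      then show ?thesis using xy by blast
    qed
  qed
  then obtain s t where st: "\<And>e. e \<in> edges G \<Longrightarrow> e = {s e, t e} \<and> s e \<noteq> t e \<and>
      (\<forall>p\<in>P. \<not> consecutive p (t e) (s e))" by metis
  define X where "X = (verts G - {r}) <+> Q"
  \<comment> \<open>Row \<open>e\<close> says that the rise from \<open>s e\<close> to
    \<open>t e\<close> equals the slope of the path of \<open>Q\<close> through \<open>e\<close>, or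
    \<open>0\<close> if there is none.\<close>
  define M :: "'a set \<Rightarrow> 'a + 'a list \<Rightarrow> real" where
    "M = (\<lambda>e. case_sum (\<lambda>v. of_bool (v = t e) - of_bool (v = s e))
                        (\<lambda>p. - of_bool (consecutive p (s e) (t e))))"
  have "card X = card (verts G) - 1 + card Q"
    unfolding X_def using finV finQ r by (simp add: card_Plus)
  moreover have "card (verts G) > 0" using r finV card_gt_0_iff by blast
  ultimately have "card (edges G) < card X" using assms(7) by linarith
  moreover have "finite X" using finV finQ by (simp add: X_def)
  ultimately obtain f where f: "\<forall>x. x \<notin> X \<longrightarrow> f x = 0" "\<exists>x\<in>X. f x \<noteq> 0"
    "\<forall>e\<in>edges G. (\<Sum>x\<in>X. M e x * f x) = 0"
    using homogeneous_system_nontrivial[of "edges G" X M] finite_edges[OF assms(1)] by blast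
  define \<phi> where "\<phi> = f \<circ> Inl"
  define a where "a = f \<circ> Inr"
  have a0: "a p = 0" if "p \<notin> Q" for p using f(1) that by (auto simp: a_def X_def)
  have r0: "\<phi> r = 0" using f(1) by (auto simp: \<phi>_def X_def)
  have out0: "\<phi> v = 0" if "v \<notin> verts G" for v using f(1) that by (auto simp: \<phi>_def X_def)
  have eq: "\<phi> (t e) - \<phi> (s e) = (\<Sum>p\<in>Q. of_bool (consecutive p (s e) (t e)) * a p)"
    if e: "e \<in> edges G" for e
  proof -
    \<comment> \<open>This also holds for \<open>w = r\<close> and for \<open>w\<close> outside the
      graph, because the potential is \<open>0\<close> there.\<close>
    have 1: "(\<Sum>v\<in>verts G - {r}. of_bool (v = w) * \<phi> v) = \<phi> w" for w
    proof (cases "w \<in> verts G - {r}")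
      case True
      have "(\<Sum>v\<in>verts G - {r}. of_bool (v = w) * \<phi> v) = (\<Sum>v\<in>verts G - {r}. if v = w then \<phi> v else 0)"
        by (intro sum.cong) auto
      then show ?thesis using True finV by simp
    next
      case False
      then show ?thesis using r0 out0 by (subst sum.neutral) auto
    qed
    have "(\<Sum>x\<in>X. M e x * f x) =
        (\<Sum>v\<in>verts G - {r}. (of_bool (v = t e) - of_bool (v = s e)) * \<phi> v)
        + (\<Sum>p\<in>Q. - of_bool (consecutive p (s e) (t e)) * a p)"
      unfolding X_def using finV finQ by (simp add: sum.Plus M_def \<phi>_def a_def)
    then show ?thesis using f(3) e
      by (simp add: left_diff_distrib sum_subtractf 1 sum_negf)
  qed
  have aff: "affine_potential G P \<phi> a"
    unfolding affine_potential_def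
  proof (intro allI impI conjI ballI)
    fix x y p assume xy: "{x, y} \<in> edges G" and p: "p \<in> P" "consecutive p x y"
    define s' t' where "s' = s {x, y}" and "t' = t {x, y}"
    have "{x, y} = {s', t'}" "\<not> consecutive p t' s'"
      unfolding s'_def t'_def using st[OF xy] p(1) by blast+
    then have e: "s {x, y} = x" "t {x, y} = y"
      using p(2) by (auto simp: doubleton_eq_iff s'_def[symmetric] t'_def[symmetric])
    \<comment> \<open>Disjointness leaves \<open>p\<close> as the only path that can contribute to
      the sum.\<close>
    have "of_bool (consecutive q x y) * a q = (if q = p then a q else 0)" if "q \<in> Q" for q
    proof (cases "consecutive q x y")
      case True
      then have "p = q"
        using same[OF p(1) _ consecutive_in_set(1)[OF p(2)]] that assms(6)
          consecutive_in_set(1)[OF True] by (meson subsetD)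
      then show ?thesis using p(2) by simp
    next
      case False
      then show ?thesis using p(2) by auto
    qed
    then have "(\<Sum>q\<in>Q. of_bool (consecutive q x y) * a q) = (\<Sum>q\<in>Q. if q = p then a q else 0)"
      by (intro sum.cong) auto
    also have "\<dots> = a p" using finQ a0 by simp
    finally show "\<phi> y - \<phi> x = a p" using eq[OF xy] e by simp
  next
    fix x y assume xy: "{x, y} \<in> edges G"
      and n: "\<forall>p\<in>P. \<not> consecutive p x y \<and> \<not> consecutive p y x"
    define s' t' where "s' = s {x, y}" and "t' = t {x, y}"
    have "{x, y} = {s', t'}"
      unfolding s'_def t'_def using st[OF xy] by blast
    then have st': "(s' = x \<and> t' = y) \<or> (s' = y \<and> t' = x)"
      by (auto simp: doubleton_eq_iff)
    then have "(\<Sum>p\<in>Q. of_bool (consecutive p s' t') * a p) = 0"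
      using n assms(6) by (intro sum.neutral) auto
    then show "\<phi> x = \<phi> y" using eq[OF xy] st' by (auto simp: s'_def[symmetric] t'_def[symmetric])
  qed
  have "\<exists>p\<in>Q. a p \<noteq> 0"
  proof (rule ccontr)
    assume "\<not> ?thesis"
    then have az: "a p = 0" for p using a0 by blast
    have "\<bar>\<phi> x - \<phi> y\<bar> \<le> 0" if "{x, y} \<in> edges G" for x y
      using affine_potential_edge[OF aff that] az by (metis abs_zero diff_self order_refl)
    then have "\<phi> v = 0" if "v \<in> verts G" for v
      using connected_graph_lipschitz[OF assms(2), of \<phi> 0 v r] that r r0 by simp
    moreover obtain x where "x \<in> X" "f x \<noteq> 0" using f(2) by blast
    ultimately show False using az by (auto simp: X_def \<phi>_def a_def)
  qed
  then show ?thesis using that aff a0 by blast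
qed

lemma consecutive_edge:
  assumes "is_path G p" "Suc j < length p"
  shows "{p ! j, p ! Suc j} \<in> edges G"
  using assms by (auto simp: is_path_def successively_conv_nth)

text \<open>The constant increments telescope from \<open>hd p\<close> to
  \<open>last p\<close>.\<close>

lemma affine_potential_ends:
  fixes \<phi> :: "'v \<Rightarrow> real"
  assumes "affine_potential G P \<phi> a" "p \<in> P" "is_path G p"
  shows "\<phi> (last p) - \<phi> (hd p) = real (path_length p) * a p"
proof -
  have step: "\<phi> (p ! Suc j) - \<phi> (p ! j) = a p" if "Suc j < length p" for j
    using assms consecutive_edge[OF assms(3) that] that
    unfolding affine_potential_def consecutive_def by blast
  have "j < length p \<Longrightarrow> \<phi> (p ! j) - \<phi> (p ! 0) = j * a p" for j
  proof (induction j)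
    case (Suc j)
    then show ?case using step[of j] by (simp add: algebra_simps)
  qed simp
  from this[of "length p - 1"] show ?thesis
    using assms(3) by (auto simp: is_path_def path_length_def hd_conv_nth last_conv_nth simp del: of_nat_diff)
qed

text \<open>A path whose slope has absolute value \<open>1\<close> carries the full rise
  \<open>diameter G\<close>. A second such path would yield two vertices, on different paths, that
  are too far apart.\<close>

lemma affine_potential_unique_steepest:
  assumes "simple_graph G" "connected_graph G" "totally_disjoint P"
    and P: "\<And>p. p \<in> P \<Longrightarrow> is_path G p \<and> path_length p = diameter G"
    and aff: "affine_potential G P \<phi> a" and le: "\<And>p. p \<in> P \<Longrightarrow> \<bar>a p\<bar> \<le> 1"
    and pq: "p \<in> P" "q \<in> P" "p \<noteq> q" "\<bar>a p\<bar> = 1" "\<bar>a q\<bar> = 1"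
  shows False
proof -
  let ?d = "real (diameter G)"
  have fin: "finite (verts G)" using assms(1) by (simp add: simple_graph_def)
  \<comment> \<open>A path of slope \<open>-1\<close> is read backwards, so from here on only a low
    end \<open>l\<close> and a high end \<open>h\<close> matter.\<close>
  have ends: "\<exists>l h. l \<in> set p \<and> h \<in> set p \<and> \<phi> h - \<phi> l = ?d" if "p \<in> P" "\<bar>a p\<bar> = 1" for p
  proof -
    have ne: "p \<noteq> []" using P that(1) by (auto simp: is_path_def)
    have eq: "\<phi> (last p) - \<phi> (hd p) = ?d * a p"
      using affine_potential_ends[OF aff that(1)] P that(1) by simp
    consider "a p = 1" | "a p = -1" using \<open>\<bar>a p\<bar> = 1\<close> by (metis abs_eq_iff abs_1)
    then show ?thesis
    proof cases
      case 1
      then show ?thesis using eq ne by (intro exI[of _ "hd p"] exI[of _ "last p"]) simp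
    next
      case 2
      then show ?thesis using eq ne by (intro exI[of _ "last p"] exI[of _ "hd p"]) simp
    qed
  qed
  have key: False
    if p: "p \<in> P" and q: "q \<in> P" and "p \<noteq> q" and l: "l \<in> set p" and h: "h \<in> set q"
      and gain: "\<phi> h - \<phi> l \<ge> ?d" for p q l h
  proof -
    have disj: "set p' \<inter> set p = {}" if "p' \<in> P" "p' \<noteq> p" for p'
      using assms(3) p that by (auto simp: totally_disjoint_def pairwise_def)
    \<comment> \<open>An edge leaving \<open>p\<close> lies on no path of \<open>P\<close>, so \<open>\<phi>\<close> is constant on it.
      Hence lowering \<open>\<phi>\<close> by one on \<open>p\<close> keeps it 1-Lipschitz.\<close>
    define \<psi> where "\<psi> = (\<lambda>v. \<phi> v - of_bool (v \<in> set p))"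
    have lip: "\<bar>\<psi> x - \<psi> y\<bar> \<le> 1" if "{x, y} \<in> edges G" for x y
      using affine_potential_edge[OF aff that]
    proof cases
      case (1 p')
      then have "x \<in> set p \<longleftrightarrow> y \<in> set p" using disj[of p'] by blast
      then show ?thesis using 1 le[of p'] by (simp add: \<psi>_def)
    next
      case 2
      then show ?thesis by (simp add: \<psi>_def)
    qed
    have V: "l \<in> verts G" "h \<in> verts G" using P p q l h by (auto simp: is_path_def)
    \<comment> \<open>Passing from \<open>\<phi>\<close> to \<open>\<psi>\<close> lowers
      \<open>l\<close> but not \<open>h\<close>, so the gap becomes at least \<open>?d + 1\<close>,
      beyond what the diameter allows.\<close>
    have "\<bar>\<psi> l - \<psi> h\<bar> \<le> 1 * real (distance G l h)"
      by (rule connected_graph_lipschitz[OF assms(2) lip V])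
    also have "\<dots> \<le> ?d" using distance_le_diameter[OF fin V] by simp
    finally have "\<bar>\<psi> l - \<psi> h\<bar> \<le> ?d" .
    moreover have "h \<notin> set p" using disj[of q] q \<open>p \<noteq> q\<close> h by blast
    ultimately show False using gain l by (simp add: \<psi>_def)
  qed
  obtain l h where p: "l \<in> set p" "h \<in> set p" "\<phi> h - \<phi> l = ?d" using ends pq by blast
  obtain l' h' where q: "l' \<in> set q" "h' \<in> set q" "\<phi> h' - \<phi> l' = ?d" using ends pq by blast
  \<comment> \<open>Starting from the lower of the two low ends, the climb to the high end of the
    other path is at least \<open>?d\<close>.\<close>
  show False
  proof (cases "\<phi> l \<le> \<phi> l'")
    case True
    then show False using key[of p q l h'] pq p q by simp
  next
    case False
    then show False using key[of q p l' h] pq p q by simp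
  qed
qed

section \<open>The lower bound\<close>

text \<open>Moving from \<open>a\<close> in direction \<open>b\<close>, one stops as soon as a
  coordinate that actually moves reaches absolute value \<open>1\<close>. As \<open>b q\<close> is
  nonzero, \<open>q\<close> differs from every path on which \<open>b\<close> vanishes.\<close>

lemma raise_to_abs_one:
  fixes a b :: "'a \<Rightarrow> real"
  assumes "finite P" "\<And>p. p \<in> P \<Longrightarrow> \<bar>a p\<bar> \<le> 1" "\<exists>p\<in>P. b p \<noteq> 0"
  obtains t q where "q \<in> P" "b q \<noteq> 0" "\<bar>a q + t * b q\<bar> = 1"
    "\<And>p. p \<in> P \<Longrightarrow> \<bar>a p + t * b p\<bar> \<le> 1"
proof -
  define J where "J = {p \<in> P. b p \<noteq> 0}"
  \<comment> \<open>The time at which coordinate \<open>p\<close> reaches the bound. Multiplying by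
    \<open>sgn (b p)\<close> makes every moving coordinate increase, so only the upper bound
    \<open>1\<close> can be hit.\<close>
  define \<tau> where "\<tau> = (\<lambda>p. (1 - sgn (b p) * a p) / \<bar>b p\<bar>)"
  have J: "finite J" "J \<noteq> {}" using assms by (auto simp: J_def)
  obtain q where q: "q \<in> J" "\<And>p. p \<in> J \<Longrightarrow> \<tau> q \<le> \<tau> p"
    using J by (metis arg_min_if_finite(1) arg_min_least)
  have sgn: "sgn (b p) * (a p + t * b p) = sgn (b p) * a p + t * \<bar>b p\<bar>" for p t
    by (simp add: distrib_left abs_sgn mult.left_commute mult.commute)
  have abs_sgn: "\<bar>sgn (b p) * c\<bar> = \<bar>c\<bar>" if "p \<in> J" for p c
    using that by (simp add: J_def abs_mult abs_sgn_eq)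
  have sa: "\<bar>sgn (b p) * a p\<bar> \<le> 1" if "p \<in> J" for p
    using abs_sgn[OF that] assms(2) that by (simp add: J_def)
  have pos: "\<bar>b p\<bar> > 0" if "p \<in> J" for p using that by (simp add: J_def)
  have \<tau>b: "\<tau> p * \<bar>b p\<bar> = 1 - sgn (b p) * a p" if "p \<in> J" for p
    using pos[OF that] by (simp add: \<tau>_def)
  have \<tau>0: "\<tau> q \<ge> 0"
    unfolding \<tau>_def using sa[OF q(1)] by (intro divide_nonneg_nonneg) auto
  show ?thesis
  proof (rule that)
    show "q \<in> P" "b q \<noteq> 0" using q(1) by (auto simp: J_def)
    show "\<bar>a q + \<tau> q * b q\<bar> = 1"
      using abs_sgn[OF q(1), of "a q + \<tau> q * b q"] by (simp add: sgn \<tau>b q(1))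
    fix p assume "p \<in> P"
    show "\<bar>a p + \<tau> q * b p\<bar> \<le> 1"
    proof (cases "p \<in> J")
      case True
      have "\<tau> q * \<bar>b p\<bar> \<le> 1 - sgn (b p) * a p"
        using q(2)[OF True] pos[OF True] \<tau>b[OF True] by (metis mult_right_mono abs_ge_zero)
      moreover have "\<tau> q * \<bar>b p\<bar> \<ge> 0" using \<tau>0 by simp
      ultimately have "\<bar>sgn (b p) * (a p + \<tau> q * b p)\<bar> \<le> 1"
        using sa[OF True] unfolding sgn by linarith
      then show ?thesis using abs_sgn[OF True] by simp
    next
      case False
      then show ?thesis using \<open>p \<in> P\<close> assms(2) by (simp add: J_def)
    qed
  qed
qed

text \<open>A first solution is scaled so that its steepest path \<open>p\<close> has slope
  \<open>1\<close>. A second one with slope \<open>0\<close> on \<open>p\<close> is added in the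
  right amount to make another path equally steep, which is impossible.\<close>

lemma card_edges_ge_verts:
  assumes "simple_graph G" "connected_graph G" "finite P" "totally_disjoint P"
    and P: "\<And>p. p \<in> P \<Longrightarrow> is_path G p \<and> path_length p = diameter G"
    and "P \<noteq> {}"
  shows "card (verts G) + card P \<le> card (edges G) + 2"
proof (rule ccontr)
  assume "\<not> ?thesis"
  then have less: "card (edges G) + 2 < card (verts G) + card P" by simp
  have path: "is_path G p" if "p \<in> P" for p using P that by blast
  note ex = affine_potential_exists[OF assms(1-4) path]
  obtain \<phi> a where a: "affine_potential G P \<phi> a" "\<exists>p\<in>P. a p \<noteq> 0"
  proof (rule ex[of P])
    show "Suc (card (edges G)) < card (verts G) + card P" using less by simp
  qed auto
  obtain p where p: "p \<in> P" "\<And>q. q \<in> P \<Longrightarrow> \<bar>a q\<bar> \<le> \<bar>a p\<bar>"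
  proof -
    have "Max ((\<lambda>p. \<bar>a p\<bar>) ` P) \<in> (\<lambda>p. \<bar>a p\<bar>) ` P" using assms(3,6) by simp
    then obtain p where "p \<in> P" "\<bar>a p\<bar> = Max ((\<lambda>p. \<bar>a p\<bar>) ` P)" by auto
    then show ?thesis using that[of p] assms(3) by simp
  qed
  then have ap: "\<bar>a p\<bar> > 0" using a(2) by fastforce
  obtain \<psi> b where b: "affine_potential G P \<psi> b" "\<And>q. q \<notin> P - {p} \<Longrightarrow> b q = 0"
      "\<exists>q\<in>P - {p}. b q \<noteq> 0"
  proof (rule ex[of "P - {p}"])
    \<comment> \<open>Forcing slope \<open>0\<close> on \<open>p\<close> costs one unknown, and
      normalising the root costs another; together they account for the constant \<open>2\<close> in
      the bound.\<close>
    show "Suc (card (edges G)) < card (verts G) + card (P - {p})"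
      using less p(1) assms(3) card_gt_0_iff[of P] by (simp add: card_Diff_singleton_if)
  qed auto
  define a' where "a' = (\<lambda>q. 1 / a p * a q)"
  have le: "\<bar>a' q\<bar> \<le> 1" if "q \<in> P" for q
    using p(2)[OF that] ap by (simp add: a'_def abs_mult divide_le_eq)
  have "\<exists>q\<in>P. b q \<noteq> 0" using b(3) by blast
  then obtain t q where q: "q \<in> P" "b q \<noteq> 0" "\<bar>a' q + t * b q\<bar> = 1"
    "\<And>p. p \<in> P \<Longrightarrow> \<bar>a' p + t * b p\<bar> \<le> 1"
    using raise_to_abs_one[where a = a' and b = b, OF assms(3) le] by blast
  \<comment> \<open>The second solution is flat on \<open>p\<close>, so the normalised slope there
    survives the addition.\<close>
  have "\<bar>a' p + t * b p\<bar> = 1" using b(2)[of p] ap by (simp add: a'_def)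
  moreover have "p \<noteq> q" using q(2) b(2)[of p] by auto
  moreover have aff: "affine_potential G P (\<lambda>x. 1 / a p * \<phi> x + t * \<psi> x) (\<lambda>q. a' q + t * b q)"
    unfolding a'_def by (rule affine_potential_combine[OF a(1) b(1)])
  ultimately show False
    using affine_potential_unique_steepest[OF assms(1,2,4) P aff q(4) p(1) q(1)] q(3) by blast
qed

text \<open>The disjoint paths occupy \<open>k * (d + 1)\<close> vertices, and
  \<open>k * (d + 1) + k - 2 = k * d + 2 * (k - 1)\<close>.\<close>

lemma card_edges_ge:
  assumes "has_disjoint_diametral_paths k d G" "k \<ge> 1"
  shows "k * d + 2 * (k - 1) \<le> card (edges G)"
proof -
  obtain P where G: "simple_graph G" "connected_graph G"
    and P: "finite P" "card P = k" "totally_disjoint P"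
    and diam: "\<And>p. p \<in> P \<Longrightarrow> diametral_path G p \<and> path_length p = d"
    using assms(1) by (auto simp: has_disjoint_diametral_paths_def)
  have path: "is_path G p \<and> path_length p = diameter G" if "p \<in> P" for p
    using diam[OF that] by (auto simp: diametral_path_def shortest_path_def)
  have "card (\<Union>p\<in>P. set p) = (\<Sum>p\<in>P. card (set p))"
    using P by (intro card_UN_disjoint) (auto simp: totally_disjoint_def pairwise_def)
  also have "\<dots> = (\<Sum>p\<in>P. d + 1)"
  proof (intro sum.cong refl)
    fix p assume "p \<in> P"
    then have "distinct p" "p \<noteq> []" "length p - 1 = d"
      using path diam by (auto simp: is_path_def path_length_def)
    then show "card (set p) = d + 1" by (cases p) (auto simp: distinct_card)
  qed
  finally have "card (\<Union>p\<in>P. set p) = k * (d + 1)" using P by simp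
  moreover have "card (\<Union>p\<in>P. set p) \<le> card (verts G)"
    using G(1) path by (intro card_mono) (auto simp: simple_graph_def is_path_def)
  moreover have "card (verts G) + card P \<le> card (edges G) + 2"
    using P assms(2) by (intro card_edges_ge_verts[OF G P(1,3) path]) auto
  ultimately show ?thesis using P(2) assms(2) by (simp add: algebra_simps)
qed

section \<open>Isomorphic copies\<close>

text \<open>Serves to move \<open>DDPG\<close>, whose vertices are pairs, to the natural numbers,
  over which \<open>MinE\<close> ranges.\<close>

definition map_graph :: "('v \<Rightarrow> 'w) \<Rightarrow> 'v ugraph \<Rightarrow> 'w ugraph" where
  "map_graph f G = \<lparr>verts = f ` verts G, edges = (`) f ` edges G\<rparr>"

context
  fixes f :: "'v \<Rightarrow> 'w"
  assumes inj: "inj f"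
begin

lemma edge_map_graph: "{f x, f y} \<in> edges (map_graph f G) \<longleftrightarrow> {x, y} \<in> edges G"
proof -
  have "{f x, f y} = f ` {x, y}" by simp
  moreover have "inj ((`) f)" using inj by (intro injI) (simp add: inj_image_eq_iff)
  ultimately show ?thesis
    by (simp add: map_graph_def inj_image_mem_iff del: image_insert)
qed

lemma is_path_map_graph: "is_path (map_graph f G) (map f p) \<longleftrightarrow> is_path G p"
proof -
  have "distinct (map f p) \<longleftrightarrow> distinct p"
    using inj by (simp add: distinct_map inj_on_subset[of f UNIV])
  moreover have "set (map f p) \<subseteq> verts (map_graph f G) \<longleftrightarrow> set p \<subseteq> verts G"
    using inj by (simp add: map_graph_def inj_image_subset_iff)
  moreover have "successively (\<lambda>u v. {u, v} \<in> edges (map_graph f G)) (map f p)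
      \<longleftrightarrow> successively (\<lambda>u v. {u, v} \<in> edges G) p"
    by (simp add: successively_map edge_map_graph)
  ultimately show ?thesis by (simp add: is_path_def)
qed

text \<open>A path of the image graph stays in the range of \<open>f\<close> and therefore pulls
  back. Both directions together identify the sets of path lengths, and hence the distances.\<close>

lemma path_between_map_graph:
  "path_between (map_graph f G) (f u) (f v) q \<longleftrightarrow> (\<exists>p. q = map f p \<and> path_between G u v p)"
proof
  assume q: "path_between (map_graph f G) (f u) (f v) q"
  then have "set q \<subseteq> range f" by (auto simp: path_between_def is_path_def map_graph_def)
  then obtain p where p: "q = map f p" by (metis ex_map_conv imageE subset_iff)
  then have "is_path G p" using q is_path_map_graph by (simp add: path_between_def)
  moreover from this have "p \<noteq> []" by (simp add: is_path_def)
  ultimately show "\<exists>p. q = map f p \<and> path_between G u v p"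
    using q p inj by (auto simp: path_between_def hd_map last_map dest: injD)
next
  assume "\<exists>p. q = map f p \<and> path_between G u v p"
  then obtain p where "q = map f p" "path_between G u v p" by blast
  moreover from this have "p \<noteq> []" by (simp add: path_between_def is_path_def)
  ultimately show "path_between (map_graph f G) (f u) (f v) q"
    using is_path_map_graph by (auto simp: path_between_def hd_map last_map)
qed

lemma distance_map_graph: "distance (map_graph f G) (f u) (f v) = distance G u v"
proof -
  have "(\<exists>q. path_between (map_graph f G) (f u) (f v) q \<and> path_length q = n)
      \<longleftrightarrow> (\<exists>p. path_between G u v p \<and> path_length p = n)" for n
    by (auto simp: path_between_map_graph path_length_def)
  then show ?thesis by (simp add: distance_def)
qed

lemma diameter_map_graph: "diameter (map_graph f G) = diameter G"
proof -
  have verts: "verts (map_graph f G) = f ` verts G" by (simp add: map_graph_def)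
  have "{distance (map_graph f G) u v | u v. u \<in> verts (map_graph f G) \<and> v \<in> verts (map_graph f G)}
      = {distance (map_graph f G) (f u) (f v) | u v. u \<in> verts G \<and> v \<in> verts G}"
    unfolding verts by blast
  then show ?thesis by (simp add: diameter_def distance_map_graph)
qed

lemma diametral_path_map_graph:
  assumes "diametral_path G p"
  shows "diametral_path (map_graph f G) (map f p)"
proof -
  have "p \<noteq> []" using assms by (simp add: diametral_path_def shortest_path_def is_path_def)
  then show ?thesis
    using assms is_path_map_graph
    by (simp add: diametral_path_def shortest_path_def hd_map last_map path_length_def
        distance_map_graph diameter_map_graph)
qed

lemma has_disjoint_diametral_paths_map_graph:
  assumes "has_disjoint_diametral_paths k d G"
  shows "has_disjoint_diametral_paths k d (map_graph f G)"
proof -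
  obtain P where G: "simple_graph G" "connected_graph G"
    and P: "finite P" "card P = k" "totally_disjoint P"
    and diam: "\<And>p. p \<in> P \<Longrightarrow> diametral_path G p \<and> path_length p = d"
    using assms by (auto simp: has_disjoint_diametral_paths_def)
  have "simple_graph (map_graph f G)"
    using G(1) inj unfolding simple_graph_def map_graph_def
    by (auto simp: card_image inj_on_subset[of f UNIV])
  moreover have "connected_graph (map_graph f G)"
    using G(2) unfolding connected_graph_def
    by (auto simp: map_graph_def[THEN arg_cong[of _ _ verts]] path_between_map_graph) blast
  moreover have "card (map f ` P) = k"
    using P inj by (simp add: card_image inj_on_subset[of "map f" UNIV])
  moreover have "totally_disjoint (map f ` P)"
    using P(3) inj by (auto simp: totally_disjoint_def pairwise_def inj_eq) blast
  moreover have "diametral_path (map_graph f G) q \<and> path_length q = d" if "q \<in> map f ` P" for q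
    using that diam diametral_path_map_graph by (auto simp: path_length_def)
  ultimately show ?thesis
    unfolding has_disjoint_diametral_paths_def using P(1) by blast
qed

lemma card_edges_map_graph: "card (edges (map_graph f G)) = card (edges G)"
proof -
  have "inj_on ((`) f) (edges G)" using inj by (intro inj_onI) (simp add: inj_image_eq_iff)
  then show ?thesis by (simp add: map_graph_def card_image)
qed

end

section \<open>The graph DDPG\<close>

text \<open>Induction from the front: if the new first vertex already lies on the path found for the
  tail, the part of that path before it is cut off.\<close>

lemma path_of_walk:
  assumes "successively (\<lambda>u v. {u, v} \<in> edges G) w" "w \<noteq> []" "set w \<subseteq> verts G"
  shows "\<exists>p. path_between G (hd w) (last w) p \<and> path_length p \<le> path_length w"
  using assms
proof (induction w)
  case (Cons x w)
  show ?case
  proof (cases "w = []")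
    case True
    then show ?thesis using Cons.prems
      by (intro exI[of _ "[x]"]) (simp add: path_between_def is_path_def)
  next
    case False
    then have w: "{x, hd w} \<in> edges G" "successively (\<lambda>u v. {u, v} \<in> edges G) w"
      using Cons.prems by (auto simp: successively_Cons)
    obtain p where p: "is_path G p" "hd p = hd w" "last p = last w"
      and "path_length p \<le> path_length w"
      using Cons.IH[OF w(2) False] Cons.prems by (auto simp: path_between_def)
    then have len: "length p \<le> length w"
      using False by (cases p; cases w) (auto simp: path_length_def)
    show ?thesis
    proof (cases "x \<in> set p")
      case True
      then obtain as bs where "p = as @ x # bs" by (meson split_list)
      then show ?thesis using p len False
        by (intro exI[of _ "x # bs"])
          (auto simp: path_between_def path_length_def is_path_def successively_append_iff)
    next
      case notin: False
      then show ?thesis using p len False w(1) Cons.prems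
        by (intro exI[of _ "x # p"])
          (auto simp: path_between_def path_length_def is_path_def successively_Cons)
    qed
  qed
qed simp

text \<open>As a relation, it turns walks of length \<open>n\<close> into \<open>n\<close>-th
  powers, so that concatenating walks becomes composition.\<close>

definition adjacency :: "'v ugraph \<Rightarrow> 'v rel" where
  "adjacency G = {(x, y). {x, y} \<in> edges G}"

lemma relpow_adjacency_sym:
  assumes "(u, v) \<in> adjacency G ^^ n"
  shows "(v, u) \<in> adjacency G ^^ n"
  using assms
proof (induction n arbitrary: v)
  case (Suc n)
  then obtain w where w: "(u, w) \<in> adjacency G ^^ n" "(w, v) \<in> adjacency G" by auto
  then have "(v, w) \<in> adjacency G" by (simp add: adjacency_def insert_commute)
  then show ?case using Suc.IH[OF w(1)] by (meson relpow_Suc_I2)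
qed simp

lemma path_of_relpow:
  assumes "simple_graph G" "(u, v) \<in> adjacency G ^^ n" "u \<in> verts G"
  obtains p where "path_between G u v p" "path_length p \<le> n"
proof -
  have "\<exists>w. successively (\<lambda>u v. {u, v} \<in> edges G) w \<and> w \<noteq> [] \<and> set w \<subseteq> verts G
      \<and> hd w = u \<and> last w = v \<and> length w = Suc n"
    using assms(2,3)
  proof (induction n arbitrary: u)
    case 0
    then show ?case by (intro exI[of _ "[u]"]) simp
  next
    case (Suc n)
    then obtain y where y: "{u, y} \<in> edges G" "(y, v) \<in> adjacency G ^^ n"
      by (metis relpow_Suc_E2 adjacency_def case_prodD mem_Collect_eq)
    then have "y \<in> verts G" using assms(1) by (auto simp: simple_graph_def)
    then obtain w where "successively (\<lambda>u v. {u, v} \<in> edges G) w" "w \<noteq> []" "set w \<subseteq> verts G"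
      "hd w = y" "last w = v" "length w = Suc n" using Suc.IH[OF y(2)] by blast
    then show ?case using y(1) Suc.prems
      by (intro exI[of _ "u # w"]) (auto simp: successively_Cons)
  qed
  then obtain w where w: "successively (\<lambda>u v. {u, v} \<in> edges G) w" "w \<noteq> []" "set w \<subseteq> verts G"
    "hd w = u" "last w = v" "length w = Suc n" by blast
  show ?thesis using path_of_walk[OF w(1-3)] w(4-6) that by (auto simp: path_length_def)
qed

lemma relpow_trans:
  assumes "(x, y) \<in> R ^^ m" "(y, z) \<in> R ^^ n"
  shows "(x, z) \<in> R ^^ (m + n)"
  using assms by (auto simp: relpow_add)

section \<open>Distances in \<open>DDPG\<close>\<close>

context
  fixes k d h h' :: nat
  assumes k: "k \<ge> 1" and d: "d \<ge> 4"
  defines "h \<equiv> d div 2" and "h' \<equiv> (d + 1) div 2"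
begin

abbreviation "DDPG_adj \<equiv> adjacency (DDPG k d)"

lemma verts_DDPG: "verts (DDPG k d) = {1..k} \<times> {0..d}"
  by (simp add: DDPG_def Let_def)

lemma edges_DDPG: "edges (DDPG k d) =
    {{(i, j), (i, j + 1)} | i j. i \<in> {1..k} \<and> j < d}
  \<union> {{(1, h), (i, h - 1)} | i. 1 < i \<and> i \<le> k}
  \<union> {{(1, h'), (i, h' + 1)} | i. 1 < i \<and> i \<le> k}"
  by (simp add: DDPG_def Let_def h_def h'_def)

lemma halves: "h + h' = d" "h \<le> h'" "h' \<le> h + 1" "2 \<le> h" "h' + 1 \<le> d"
  using d by (auto simp: h_def h'_def)

lemma simple_graph_DDPG: "simple_graph (DDPG k d)"
  unfolding simple_graph_def edges_DDPG verts_DDPG using halves k by auto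

lemma relpow_DDPG_along:
  assumes "i \<in> {1..k}" "j + m \<le> d"
  shows "((i, j), (i, j + m)) \<in> DDPG_adj ^^ m"
  using assms(2)
proof (induction m)
  case (Suc m)
  have "{(i, j + m), (i, j + m + 1)} \<in> edges (DDPG k d)"
    unfolding edges_DDPG using assms(1) Suc.prems by (intro UnI1 CollectI exI conjI) auto
  then have "((i, j + m), (i, j + Suc m)) \<in> DDPG_adj" by (simp add: adjacency_def)
  then show ?case using Suc.IH Suc.prems relpow_Suc_I by fastforce
qed simp

text \<open>The exponent is the absolute difference of \<open>j\<close> and \<open>j'\<close>,
  written without truncation.\<close>

lemma relpow_DDPG_segment:
  assumes "i \<in> {1..k}" "j \<le> d" "j' \<le> d"
  shows "((i, j), (i, j')) \<in> DDPG_adj ^^ (max j j' - min j j')"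
proof (cases "j \<le> j'")
  case True
  then show ?thesis using relpow_DDPG_along[of i j "j' - j"] assms by simp
next
  case False
  then show ?thesis using relpow_DDPG_along[of i j' "j - j'"] assms
    by (simp add: relpow_adjacency_sym)
qed

text \<open>Lower halves of rows lead to \<open>(1, h)\<close>, upper halves to
  \<open>(1, h')\<close>: along row \<open>1\<close> itself, or along row \<open>i\<close> to its
  attaching vertex and across the connecting edge.\<close>

lemma relpow_DDPG_hub:
  assumes "i \<in> {1..k}" "j \<le> d"
  shows "\<exists>c \<in> {h, h'}. \<exists>n \<le> h. ((i, j), (1, c)) \<in> DDPG_adj ^^ n"
proof (cases "i = 1")
  case True
  show ?thesis
  proof (cases "j \<le> h")
    case True
    then show ?thesis using relpow_DDPG_segment[of i j h] assms \<open>i = 1\<close> halves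
      by (intro bexI[of _ h] exI[of _ "h - j"]) auto
  next
    case False
    then have "h' \<le> j" using halves by linarith
    then show ?thesis using relpow_DDPG_segment[of i j h'] assms \<open>i = 1\<close> halves
      by (intro bexI[of _ h'] exI[of _ "j - h'"]) auto
  qed
next
  case False
  have 1: "((i, h - 1), (1, h)) \<in> DDPG_adj ^^ 1" "((i, h' + 1), (1, h')) \<in> DDPG_adj ^^ 1"
    using False assms(1) by (auto simp: adjacency_def edges_DDPG insert_commute)
  show ?thesis
  proof (cases "j \<le> h")
    case True
    have "((i, j), (1, h)) \<in> DDPG_adj ^^ (max j (h - 1) - min j (h - 1) + 1)"
      using assms halves by (intro relpow_trans[OF relpow_DDPG_segment 1(1)]) auto
    \<comment> \<open>The extreme cases are \<open>j = 0\<close>, with exactly \<open>h\<close>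
      steps, and \<open>j = h\<close>, with two; the latter relies on \<open>2 \<le> h\<close>,
      hence on \<open>d \<ge> 4\<close>.\<close>
    moreover have "max j (h - 1) - min j (h - 1) + 1 \<le> h" using True halves by linarith
    ultimately show ?thesis by blast
  next
    case False
    then have "h' \<le> j" using halves by linarith
    have "((i, j), (1, h')) \<in> DDPG_adj ^^ (max j (h' + 1) - min j (h' + 1) + 1)"
      using assms halves by (intro relpow_trans[OF relpow_DDPG_segment 1(2)]) auto
    moreover have "max j (h' + 1) - min j (h' + 1) + 1 \<le> h"
      using \<open>h' \<le> j\<close> assms(2) halves by linarith
    ultimately show ?thesis by blast
  qed
qed

text \<open>Going through the hubs takes at most \<open>h + (h' - h) + h = h + h' = d\<close>
  steps.\<close>

lemma short_path_DDPG:
  assumes "u \<in> verts (DDPG k d)" "v \<in> verts (DDPG k d)"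
  obtains p where "path_between (DDPG k d) u v p" "path_length p \<le> d"
proof -
  obtain i j i' j' where uv: "u = (i, j)" "v = (i', j')" by (metis surj_pair)
  then have ij: "i \<in> {1..k}" "j \<le> d" "i' \<in> {1..k}" "j' \<le> d"
    using assms by (auto simp: verts_DDPG)
  obtain c n where c: "c \<in> {h, h'}" "n \<le> h" "(u, (1, c)) \<in> DDPG_adj ^^ n"
    using relpow_DDPG_hub[OF ij(1,2)] uv by blast
  obtain c' n' where c': "c' \<in> {h, h'}" "n' \<le> h" "(v, (1, c')) \<in> DDPG_adj ^^ n'"
    using relpow_DDPG_hub[OF ij(3,4)] uv by blast
  have "((1, c), (1, c')) \<in> DDPG_adj ^^ (max c c' - min c c')"
    using c(1) c'(1) k halves by (intro relpow_DDPG_segment) auto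
  then have walk: "(u, v) \<in> DDPG_adj ^^ (n + (max c c' - min c c') + n')"
    using relpow_trans c(3) relpow_adjacency_sym[OF c'(3)] by meson
  obtain p where "path_between (DDPG k d) u v p" "path_length p \<le> n + (max c c' - min c c') + n'"
    using path_of_relpow[OF simple_graph_DDPG walk assms(1)] .
  moreover have "n + (max c c' - min c c') + n' \<le> d" using c c' halves by auto
  ultimately show ?thesis using that le_trans by blast
qed

lemma connected_graph_DDPG: "connected_graph (DDPG k d)"
  unfolding connected_graph_def
proof (intro conjI ballI)
  show "verts (DDPG k d) \<noteq> {}" using k by (simp add: verts_DDPG)
  show "\<exists>p. path_between (DDPG k d) u v p"
    if "u \<in> verts (DDPG k d)" "v \<in> verts (DDPG k d)" for u v
    using short_path_DDPG[OF that] by blast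
qed

lemma distance_DDPG_le:
  assumes "u \<in> verts (DDPG k d)" "v \<in> verts (DDPG k d)"
  shows "distance (DDPG k d) u v \<le> d"
proof -
  obtain p where "path_between (DDPG k d) u v p" "path_length p \<le> d"
    using short_path_DDPG[OF assms] .
  then show ?thesis using distance_le[of "DDPG k d" u v p] by simp
qed

lemma distance_DDPG_ends:
  assumes "i \<in> {1..k}"
  shows "distance (DDPG k d) (i, 0) (i, d) = d"
proof (rule antisym)
  have V: "(i, 0) \<in> verts (DDPG k d)" "(i, d) \<in> verts (DDPG k d)"
    using assms by (auto simp: verts_DDPG)
  show "distance (DDPG k d) (i, 0) (i, d) \<le> d" using distance_DDPG_le V by blast
  \<comment> \<open>Row edges and connecting edges alike change the second coordinate by
    one.\<close>
  have "\<bar>real (snd x) - real (snd y)\<bar> \<le> 1" if "{x, y} \<in> edges (DDPG k d)" for x y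
    using that halves by (auto simp: edges_DDPG doubleton_eq_iff)
  from connected_graph_lipschitz[where \<psi> = "\<lambda>x. real (snd x)", OF connected_graph_DDPG this V]
  show "d \<le> distance (DDPG k d) (i, 0) (i, d)" by simp
qed

lemma diameter_DDPG: "diameter (DDPG k d) = d"
  unfolding diameter_def
proof (rule Max_eqI)
  show "finite {distance (DDPG k d) u v | u v. u \<in> verts (DDPG k d) \<and> v \<in> verts (DDPG k d)}"
    using simple_graph_DDPG by (intro finite_distances) (simp add: simple_graph_def)
  show "x \<le> d"
    if "x \<in> {distance (DDPG k d) u v | u v. u \<in> verts (DDPG k d) \<and> v \<in> verts (DDPG k d)}" for x
    using that distance_DDPG_le by blast
  have "(1, 0) \<in> verts (DDPG k d)" "(1, d) \<in> verts (DDPG k d)" using k by (auto simp: verts_DDPG)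
  then show "d \<in> {distance (DDPG k d) u v | u v. u \<in> verts (DDPG k d) \<and> v \<in> verts (DDPG k d)}"
    using distance_DDPG_ends[of 1] k by force
qed

section \<open>The rows as diametral paths, and the number of edges\<close>

lemma has_disjoint_diametral_paths_DDPG: "has_disjoint_diametral_paths k d (DDPG k d)"
proof -
  define row where "row = (\<lambda>i::nat. map (Pair i) [0..<d + 1])"
  have hd_last: "hd (row i) = (i, 0)" "last (row i) = (i, d)" "path_length (row i) = d" for i :: nat
    by (simp_all add: row_def hd_map last_map path_length_def del: upt_Suc)
  have set_row: "set (row i) = {i} \<times> {0..d}" for i :: nat
    by (auto simp: row_def simp del: upt_Suc)
  have "is_path (DDPG k d) (row i)" if "i \<in> {1..k}" for i
  proof -
    have "distinct (row i)" by (simp add: row_def distinct_map inj_on_def del: upt_Suc)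
    moreover have "successively (\<lambda>u v. {u, v} \<in> edges (DDPG k d)) (row i)"
      unfolding row_def successively_conv_nth using that
      by (auto simp: edges_DDPG nth_append simp del: upt_Suc)
    ultimately show ?thesis
      using that set_row by (auto simp: is_path_def verts_DDPG row_def simp del: upt_Suc)
  qed
  then have diam: "diametral_path (DDPG k d) (row i)" if "i \<in> {1..k}" for i
    using that by (simp add: diametral_path_def shortest_path_def hd_last
        distance_DDPG_ends diameter_DDPG)
  have "inj row" using hd_last(1) by (metis injI prod.inject)
  then have "card (row ` {1..k}) = k" by (simp add: card_image inj_on_subset[of row UNIV])
  moreover have "totally_disjoint (row ` {1..k})"
    by (auto simp: totally_disjoint_def pairwise_def set_row)
  ultimately show ?thesis
    unfolding has_disjoint_diametral_paths_def
    using simple_graph_DDPG connected_graph_DDPG diam hd_last(3)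
    by (intro conjI exI[of _ "row ` {1..k}"]) auto
qed

text \<open>Counting the index sets of the three edge families gives exactly the value of the lower
  bound \<open>card_edges_ge\<close>.\<close>

lemma card_edges_DDPG_le: "card (edges (DDPG k d)) \<le> k * d + 2 * (k - 1)"
proof -
  let ?A = "(\<lambda>(i, j). {(i, j), (i, j + 1)}) ` ({1..k} \<times> {..<d})"
  let ?B = "(\<lambda>i. {(1, h), (i, h - 1)}) ` {1<..k}"
  let ?C = "(\<lambda>i. {(1, h'), (i, h' + 1)}) ` {1<..k}"
  have "{f i j | i j. i \<in> {1..k} \<and> j < d} = (\<lambda>(i, j). f i j) ` ({1..k} \<times> {..<d})"
    "{g i | i. 1 < i \<and> i \<le> k} = g ` {1<..k}" 
    for f :: "nat \<Rightarrow> nat \<Rightarrow> (nat \<times> nat) set" and g :: "nat \<Rightarrow> (nat \<times> nat) set"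
    by fastforce+
  then have "edges (DDPG k d) = ?A \<union> ?B \<union> ?C" unfolding edges_DDPG by presburger
  then have "card (edges (DDPG k d)) \<le> card ?A + card ?B + card ?C"
    using card_Un_le[of "?A \<union> ?B" ?C] card_Un_le[of ?A ?B] by simp
  moreover have "card ?A \<le> card ({1..k} \<times> {..<d})" by (rule card_image_le) simp
  moreover have "card ?B \<le> card {1<..k}" by (rule card_image_le) simp
  moreover have "card ?C \<le> card {1<..k}" by (rule card_image_le) simp
  moreover have "card ({1..k} \<times> {..<d}) = k * d" "card {1<..k} = k - 1" by simp_all
  ultimately show ?thesis by linarith
qed

lemma card_edges_DDPG_minimal:
  assumes "has_disjoint_diametral_paths k d G"
  shows "card (edges (DDPG k d)) \<le> card (edges G)"
  using card_edges_ge[OF assms k] card_edges_DDPG_le by linarith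

end

theorem theorem11:
  fixes k d :: nat
  assumes "k \<ge> 1" and "d \<ge> 4"
  shows "extremal k d (DDPG k d) \<and>
         (\<forall>G :: 'v ugraph. has_disjoint_diametral_paths k d G \<longrightarrow>
            card (edges (DDPG k d)) \<le> card (edges G))"
proof -
  have D: "has_disjoint_diametral_paths k d (DDPG k d)"
    using has_disjoint_diametral_paths_DDPG assms by blast
  \<comment> \<open>A copy on the natural numbers is a witness for the minimum in
    \<open>MinE\<close>; the lower bound itself holds for every vertex type.\<close>
  define G where "G = map_graph to_nat (DDPG k d)"
  have "has_disjoint_diametral_paths k d G" "card (edges G) = card (edges (DDPG k d))"
    unfolding G_def using D
    by (simp_all add: has_disjoint_diametral_paths_map_graph card_edges_map_graph)
  then have "MinE k d = card (edges (DDPG k d))"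
    unfolding MinE_def using card_edges_DDPG_minimal[OF assms] by (intro Least_equality) auto
  then show ?thesis using D by (auto simp: extremal_def intro: card_edges_DDPG_minimal[OF assms])
qed

end
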